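(* In the (noncommutative) two-spin spinor algebra $\mathcal A_{\mathrm{spin}}^{\mathbb C}:=\mathrm{Mat}(2,\mathbb C)\otimes\mathrm{Mat}(2,\mathbb C)\cong\mathrm{Mat}(4,\mathbb C)$ there exist $\pm1$ observables $A_0,A_1,B_0,B_1$ (with $[A_x,B_y]=0$ for all $x,y\in\{0,1\}$, for locality) such that the corresponding CHSH operator $$S_{\mathrm{spin}}:=A_0B_0+A_0B_1+A_1B_0-A_1B_1$$ has $$\operatorname{spec}(S_{\mathrm{spin}})=\{2\sqrt2,\,-2\sqrt2,\,0,\,0\},\qquad \|S_{\mathrm{spin}}\|=2\sqrt2 .$$ Equivalently, in the real representation of this algebra via the realification map $\Phi$, there exists a real matrix $S_{\mathrm Q}$ with $$\operatorname{spec}(S_{\mathrm Q})=\{2\sqrt2,\,-2\sqrt2,\,0,\,0\}.$$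
   Context: A $\pm1$ observable is a Hermitian matrix whose square is the identity. Locality is implemented as strict tensor-factor separation: $A_0,A_1$ (Alice) act on the first tensor factor and $B_0,B_1$ (Bob) on the second, so all Alice observables commute with all Bob observables. Spectra are listed with multiplicity and $\|\cdot\|$ is the operator (spectral) norm. The realification map $\Phi$ sends a complex matrix $U=A+iB$, with $A,B\in\mathrm{Mat}(2^m,\mathbb R)$, to $\Phi(U):=A\otimes I+B\otimes W\in\mathrm{Mat}(2^{m+1},\mathbb R)$, where $I$ is the $2\times2$ identity and $W=\begin{pmatrix}0&-1\\1&0\end{pmatrix}$. The real representation ("Natural Qubit Algebra", NQA, representation) uses real linear combinations of Kronecker products of the real blocks $I$, $X=\begin{pmatrix}0&1\\1&0\end{pmatrix}$, $Z=\begin{pmatrix}1&0\\0&-1\end{pmatrix}$, $W$. The symbol $S_{\mathrm Q}$ refers to the CHSH operator for the standard CHSH choice of local $\pm1$ observables in a real $4\times4$ model (described by the source as equivalent to starting in $\mathrm{Mat}(4,\mathbb C)$ and realifying via $\Phi$), given by $$S_{\mathrm Q}=\begin{pmatrix}\sqrt2&0&0&\sqrt2\\0&-\sqrt2&\sqrt2&0\\0&\sqrt2&-\sqrt2&0\\\sqrt2&0&0&\sqrt2\end{pmatrix}.$$ *)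

theory Defs
  imports
    Complex_Main
    "HOL-Library.Multiset"
    "HOL-Computational_Algebra.Polynomial"
    "Jordan_Normal_Form.Matrix"
    "Jordan_Normal_Form.Char_Poly"
    "Jordan_Normal_Form.Schur_Decomposition"
begin

text \<open>Kronecker product in the usual ordering, the right factor varying fastest.
  It realises the identification of \<open>Mat(2) \<otimes> Mat(2)\<close> with \<open>Mat(4)\<close>.\<close>

definition kron :: "'a :: semiring_1 mat \<Rightarrow> 'a mat \<Rightarrow> 'a mat" where
  "kron A B = mat (dim_row A * dim_row B) (dim_col A * dim_col B)
     (\<lambda>(i, j). A $$ (i div dim_row B, j div dim_col B) * B $$ (i mod dim_row B, j mod dim_col B))"

text \<open>Over the reals \<^const>\<open>conjugate\<close> is the identity, so that a real matrix is Hermitian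
  if and only if it is symmetric.\<close>

definition pm_observable :: "nat \<Rightarrow> 'a :: conjugatable_field mat \<Rightarrow> bool" where
  "pm_observable n A \<longleftrightarrow> A \<in> carrier_mat n n \<and> mat_adjoint A = A \<and> A * A = 1\<^sub>m n"

definition acts_on_first :: "'a :: semiring_1 mat \<Rightarrow> bool" where
  "acts_on_first A \<longleftrightarrow> (\<exists>a \<in> carrier_mat 2 2. A = kron a (1\<^sub>m 2))"

definition acts_on_second :: "'a :: semiring_1 mat \<Rightarrow> bool" where
  "acts_on_second B \<longleftrightarrow> (\<exists>b \<in> carrier_mat 2 2. B = kron (1\<^sub>m 2) b)"

text \<open>The commutation clause is implied by the tensor-factor separation; it is kept because
  it is an explicit requirement.\<close>

definition local_pm_observables ::
    "'a :: conjugatable_field mat \<Rightarrow> 'a mat \<Rightarrow> 'a mat \<Rightarrow> 'a mat \<Rightarrow> bool" where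
  "local_pm_observables A\<^sub>0 A\<^sub>1 B\<^sub>0 B\<^sub>1 \<longleftrightarrow>
     (\<forall>A \<in> {A\<^sub>0, A\<^sub>1}. pm_observable 4 A \<and> acts_on_first A) \<and>
     (\<forall>B \<in> {B\<^sub>0, B\<^sub>1}. pm_observable 4 B \<and> acts_on_second B) \<and>
     (\<forall>A \<in> {A\<^sub>0, A\<^sub>1}. \<forall>B \<in> {B\<^sub>0, B\<^sub>1}. A * B = B * A)"

definition chsh :: "'a :: ring_1 mat \<Rightarrow> 'a mat \<Rightarrow> 'a mat \<Rightarrow> 'a mat \<Rightarrow> 'a mat" where
  "chsh A\<^sub>0 A\<^sub>1 B\<^sub>0 B\<^sub>1 = A\<^sub>0 * B\<^sub>0 + A\<^sub>0 * B\<^sub>1 + A\<^sub>1 * B\<^sub>0 - A\<^sub>1 * B\<^sub>1"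

text \<open>Eigenvalues listed with algebraic multiplicity. The spectrum of a real matrix is taken
  over the complex numbers.\<close>

definition spec :: "complex mat \<Rightarrow> complex multiset" where
  "spec A = proots (char_poly A)"

definition spec_real :: "real mat \<Rightarrow> complex multiset" where
  "spec_real A = spec (map_mat complex_of_real A)"

definition euclidean_norm :: "complex vec \<Rightarrow> real" where
  "euclidean_norm v = sqrt (\<Sum>i<dim_vec v. (cmod (v $ i))\<^sup>2)"

definition operator_norm :: "complex mat \<Rightarrow> real" where
  "operator_norm A =
     Sup {euclidean_norm (A *\<^sub>v v) | v. v \<in> carrier_vec (dim_col A) \<and> euclidean_norm v = 1}"

definition W_block :: "real mat" where
  "W_block = mat_of_rows_list 2 [[0, -1], [1, 0]]"

definition realify :: "complex mat \<Rightarrow> real mat" where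
  "realify U = kron (map_mat Re U) (1\<^sub>m 2) + kron (map_mat Im U) W_block"

text \<open>The simple eigenvalues of the following matrix prevent it from being of the form
  \<open>realify U\<close>, whose eigenvalues over the reals have even multiplicity. It is the real form of a complex
  \<open>4 \<times> 4\<close> operator \<open>S\<close> in the sense that \<open>realify S = kron S_Q (1\<^sub>m 2)\<close>.\<close>

definition S_Q :: "real mat" where
  "S_Q = mat_of_rows_list 4
     [[sqrt 2, 0, 0, sqrt 2],
      [0, - sqrt 2, sqrt 2, 0],
      [0, sqrt 2, - sqrt 2, 0],
      [sqrt 2, 0, 0, sqrt 2]]"

end

theory Submission
  imports Defs
begin

text \<open>The observables \<open>Z \<otimes> I\<close>, \<open>X \<otimes> I\<close> and \<open>I \<otimes> (Z \<plusminus> X) / \<surd>2\<close> are real and have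
  \<open>S_Q = \<surd>2 (Z \<otimes> Z + X \<otimes> X)\<close> as CHSH operator. It acts on the span of \<open>e\<^sub>0, e\<^sub>3\<close> as
  \<open>\<surd>2 (I + X)\<close> and on the span of \<open>e\<^sub>1, e\<^sub>2\<close> as \<open>-\<surd>2 (I - X)\<close>, so that the Bell basis
  diagonalises it. Since all entries are real, \<open>realify\<close> is just \<open>_ \<otimes> I\<close> on these operators.\<close>

section \<open>Algebra of Kronecker products\<close>

lemma kron_dim [simp]:
  "dim_row (kron A B) = dim_row A * dim_row B"
  "dim_col (kron A B) = dim_col A * dim_col B"
  by (simp_all add: kron_def)

lemma kron_index:
  assumes "i < dim_row A * dim_row B" "j < dim_col A * dim_col B"
  shows "kron A B $$ (i, j) =
    A $$ (i div dim_row B, j div dim_col B) * B $$ (i mod dim_row B, j mod dim_col B)"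
  using assms by (simp add: kron_def)

lemma div_mod_less:
  fixes i m n :: nat
  assumes "i < m * n"
  shows "i div n < m" "i mod n < n"
proof -
  \<comment> \<open>At \<open>n = 0\<close> the remainder bound would fail, but then
    \<open>m * n = 0\<close> admits no \<open>i\<close>.\<close>
  have "0 < n" using assms by (cases n) auto
  with assms show "i div n < m" "i mod n < n" by (auto simp: less_mult_imp_div_less)
qed

text \<open>The range splits into \<open>n\<close> consecutive blocks of length \<open>q\<close>; on
  each of them \<open>k div q\<close> is constant while \<open>k mod q\<close> runs through all
  residues.\<close>

lemma sum_div_mod:
  fixes f g :: "nat \<Rightarrow> 'a :: comm_semiring_0"
  shows "(\<Sum>k<n * q. f (k div q) * g (k mod q)) = (\<Sum>k<n. f k) * (\<Sum>k<q. g k)"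
proof -
  have "(\<Sum>k<n * q. f (k div q) * g (k mod q)) =
      (\<Sum>m<n. \<Sum>k = m * q..<m * q + q. f (k div q) * g (k mod q))"
    by (simp add: sum.nat_group)
  also have "\<dots> = (\<Sum>m<n. \<Sum>k<q. f m * g k)"
  proof (rule sum.cong [OF refl])
    fix m
    show "(\<Sum>k = m * q..<m * q + q. f (k div q) * g (k mod q)) = (\<Sum>k<q. f m * g k)"
      using sum.shift_bounds_nat_ivl [of "\<lambda>k. f (k div q) * g (k mod q)" 0 "m * q" q]
      by (simp add: lessThan_atLeast0 add.commute)
  qed
  finally show ?thesis by (simp add: sum_product)
qed

text \<open>Commutativity of the scalars regroups each summand of the matrix product into a factor
  in \<open>k div dim_row D\<close> and one in \<open>k mod dim_row D\<close>, whereupon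
  \<open>sum_div_mod\<close> splits the sum.\<close>

lemma kron_mult:
  fixes A B C D :: "'a :: comm_semiring_1 mat"
  assumes "dim_col A = dim_row C" "dim_col B = dim_row D"
  shows "kron A B * kron C D = kron (A * C) (B * D)"
proof (rule eq_matI)
  fix i j
  assume "i < dim_row (kron (A * C) (B * D))" "j < dim_col (kron (A * C) (B * D))"
  then have i: "i < dim_row A * dim_row B" and j: "j < dim_col C * dim_col D" by simp_all
  note ij = div_mod_less [OF i] div_mod_less [OF j]
  have "(kron A B * kron C D) $$ (i, j) =
      (\<Sum>k<dim_row C * dim_row D.
         (A $$ (i div dim_row B, k div dim_row D) * C $$ (k div dim_row D, j div dim_col D)) *
         (B $$ (i mod dim_row B, k mod dim_row D) * D $$ (k mod dim_row D, j mod dim_col D)))"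
    using i j assms
    by (auto simp: scalar_prod_def lessThan_atLeast0 kron_index ac_simps intro!: sum.cong)
  also have "\<dots> = kron (A * C) (B * D) $$ (i, j)"
    using i j ij assms
    by (subst sum_div_mod [where
          f = "\<lambda>k. A $$ (i div dim_row B, k) * C $$ (k, j div dim_col D)" and
          g = "\<lambda>k. B $$ (i mod dim_row B, k) * D $$ (k, j mod dim_col D)"])
      (simp add: kron_index scalar_prod_def lessThan_atLeast0)
  finally show "(kron A B * kron C D) $$ (i, j) = kron (A * C) (B * D) $$ (i, j)" .
qed simp_all

lemma kron_one: "kron (1\<^sub>m m) (1\<^sub>m n) = 1\<^sub>m (m * n)"
proof (rule eq_matI)
  fix i j assume "i < dim_row (1\<^sub>m (m * n))" "j < dim_col (1\<^sub>m (m * n))"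
  then have ij: "i < m * n" "j < m * n" by simp_all
  have "i = j" if "i div n = j div n" "i mod n = j mod n"
    using that by (metis div_mult_mod_eq)
  with ij div_mod_less [OF ij(1)] div_mod_less [OF ij(2)]
  show "kron (1\<^sub>m m) (1\<^sub>m n) $$ (i, j) = 1\<^sub>m (m * n) $$ (i, j)"
    by (auto simp: kron_index)
qed simp_all

section \<open>Adjoints, observables and locality\<close>

lemma mat_adjoint_dim [simp]:
  "dim_row (mat_adjoint A) = dim_col A" "dim_col (mat_adjoint A) = dim_row A"
  by (simp_all add: mat_adjoint_def)

lemma mat_adjoint_index:
  "i < dim_col A \<Longrightarrow> j < dim_row A \<Longrightarrow> mat_adjoint A $$ (i, j) = conjugate (A $$ (j, i))"
  by (simp add: mat_adjoint_def mat_of_rows_index)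

lemma mat_adjoint_kron: "mat_adjoint (kron A B) = kron (mat_adjoint A) (mat_adjoint B)"
proof (rule eq_matI)
  fix i j
  assume "i < dim_row (kron (mat_adjoint A) (mat_adjoint B))"
    "j < dim_col (kron (mat_adjoint A) (mat_adjoint B))"
  then have i: "i < dim_col A * dim_col B" and j: "j < dim_row A * dim_row B" by simp_all
  with div_mod_less [OF i] div_mod_less [OF j]
  show "mat_adjoint (kron A B) $$ (i, j) = kron (mat_adjoint A) (mat_adjoint B) $$ (i, j)"
    by (simp add: mat_adjoint_index kron_index conjugate_dist_mul)
qed simp_all

lemma pm_observable_kron:
  assumes "pm_observable m A" "pm_observable n B"
  shows "pm_observable (m * n) (kron A B)"
  using assms by (auto simp: pm_observable_def mat_adjoint_kron kron_mult kron_one)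

text \<open>By multiplicativity \<open>conjugate 1\<close> is idempotent, hence 0 or 1 in a field;
  it is not 0 because only 0 has conjugate 0.\<close>

lemma conjugate_one: "conjugate (1 :: 'a :: conjugatable_field) = 1"
proof -
  have "conjugate (1 :: 'a) * conjugate 1 = conjugate 1"
    using conjugate_dist_mul [of "1 :: 'a" 1] by simp
  then show ?thesis by simp
qed

lemma pm_observable_one: "pm_observable n (1\<^sub>m n)"
  by (auto simp: pm_observable_def mat_adjoint_index conjugate_one intro!: eq_matI)

text \<open>Both orders collapse to the same matrix, which yields the commutation of the two parties
  and turns the CHSH operator into a combination of Kronecker products.\<close>

lemma kron_first_mult_second:
  fixes a b :: "'a :: comm_semiring_1 mat"
  assumes "a \<in> carrier_mat m m" "b \<in> carrier_mat n n"
  shows "kron a (1\<^sub>m n) * kron (1\<^sub>m m) b = kron a b" "kron (1\<^sub>m m) b * kron a (1\<^sub>m n) = kron a b"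
  using assms by (auto simp: kron_mult)

text \<open>Only the single-spin factors remain to be checked: tensoring with the identity, itself
  an observable, preserves observables.\<close>

lemma local_pm_observables_kron:
  assumes "\<forall>a \<in> {a\<^sub>0, a\<^sub>1, b\<^sub>0, b\<^sub>1}. pm_observable 2 a"
  shows "local_pm_observables (kron a\<^sub>0 (1\<^sub>m 2)) (kron a\<^sub>1 (1\<^sub>m 2)) (kron (1\<^sub>m 2) b\<^sub>0) (kron (1\<^sub>m 2) b\<^sub>1)"
proof -
  have carr: "a \<in> carrier_mat 2 2" if "a \<in> {a\<^sub>0, a\<^sub>1, b\<^sub>0, b\<^sub>1}" for a
    using assms that by (auto simp: pm_observable_def)
  have "pm_observable 4 (kron a (1\<^sub>m 2))" "pm_observable 4 (kron (1\<^sub>m 2) a)"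
    if "a \<in> {a\<^sub>0, a\<^sub>1, b\<^sub>0, b\<^sub>1}" for a
    using pm_observable_kron [OF _ pm_observable_one, of 2 a 2]
      pm_observable_kron [OF pm_observable_one, of 2 a 2] assms that by auto
  then show ?thesis
    using carr
    by (auto simp: local_pm_observables_def acts_on_first_def acts_on_second_def
        kron_first_mult_second)
qed

section \<open>Real matrices as complex matrices, realification, CHSH operators of Kronecker
  form\<close>

lemma map_mat_of_real_kron:
  "map_mat complex_of_real (kron A B) = kron (map_mat complex_of_real A) (map_mat complex_of_real B)"
  by (rule eq_matI) (auto simp: kron_index div_mod_less)

lemma pm_observable_of_real:
  assumes "pm_observable n a"
  shows "pm_observable n (map_mat complex_of_real a)"
proof -
  have a: "a \<in> carrier_mat n n" "mat_adjoint a = a" "a * a = 1\<^sub>m n"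
    using assms by (simp_all add: pm_observable_def)
  have "mat_adjoint (map_mat complex_of_real a) = map_mat complex_of_real (mat_adjoint a)"
    using a(1) by (auto simp: mat_adjoint_index intro!: eq_matI)
  moreover have "map_mat complex_of_real a * map_mat complex_of_real a = 1\<^sub>m n"
    using of_real_hom.mat_hom_mult [OF a(1) a(1)]
    by (metis a(3) of_real_hom.mat_hom_one)
  ultimately show ?thesis
    using a by (simp add: pm_observable_def)
qed

lemma realify_of_real: "realify (map_mat complex_of_real A) = kron A (1\<^sub>m 2)"
  by (rule eq_matI)
    (auto simp: realify_def kron_index div_mod_less W_block_def mat_of_rows_list_def)

lemma chsh_kron:
  fixes a\<^sub>0 :: "'a :: comm_ring_1 mat"
  assumes "a\<^sub>0 \<in> carrier_mat m m" "a\<^sub>1 \<in> carrier_mat m m" "b\<^sub>0 \<in> carrier_mat n n" "b\<^sub>1 \<in> carrier_mat n n"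
  shows "chsh (kron a\<^sub>0 (1\<^sub>m n)) (kron a\<^sub>1 (1\<^sub>m n)) (kron (1\<^sub>m m) b\<^sub>0) (kron (1\<^sub>m m) b\<^sub>1) =
    kron a\<^sub>0 b\<^sub>0 + kron a\<^sub>0 b\<^sub>1 + kron a\<^sub>1 b\<^sub>0 - kron a\<^sub>1 b\<^sub>1"
  using assms by (simp add: chsh_def kron_first_mult_second)

section \<open>The concrete observables and their CHSH operator\<close>

definition pauli_Z :: "real mat" where
  "pauli_Z = mat_of_rows_list 2 [[1, 0], [0, -1]]"

definition pauli_X :: "real mat" where
  "pauli_X = mat_of_rows_list 2 [[0, 1], [1, 0]]"

text \<open>The Hadamard matrix \<open>(Z + X) / sqrt 2\<close>; its companion
  \<open>bob_minus\<close> is \<open>(Z - X) / sqrt 2\<close>. Their sum is \<open>sqrt 2\<close>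
  times \<open>Z\<close> and their difference \<open>sqrt 2\<close> times \<open>X\<close>.\<close>

definition bob_plus :: "real mat" where
  "bob_plus = mat_of_rows_list 2 [[1 / sqrt 2, 1 / sqrt 2], [1 / sqrt 2, - 1 / sqrt 2]]"

definition bob_minus :: "real mat" where
  "bob_minus = mat_of_rows_list 2 [[1 / sqrt 2, - 1 / sqrt 2], [- 1 / sqrt 2, - 1 / sqrt 2]]"

lemmas local_obs_defs = pauli_Z_def pauli_X_def bob_plus_def bob_minus_def

lemma local_obs_carrier [simp]:
  "pauli_Z \<in> carrier_mat 2 2" "pauli_X \<in> carrier_mat 2 2"
  "bob_plus \<in> carrier_mat 2 2" "bob_minus \<in> carrier_mat 2 2"
  by (auto intro!: carrier_matI simp: local_obs_defs mat_of_rows_list_def)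

lemma local_obs_dim [simp]:
  "dim_row pauli_Z = 2" "dim_row pauli_X = 2" "dim_row bob_plus = 2" "dim_row bob_minus = 2"
  "dim_col pauli_Z = 2" "dim_col pauli_X = 2" "dim_col bob_plus = 2" "dim_col bob_minus = 2"
  using local_obs_carrier by (auto simp del: local_obs_carrier)

lemma eq_mat_2I:
  assumes "A \<in> carrier_mat 2 2" "B \<in> carrier_mat 2 2"
    and "\<And>i j. i \<in> {0, 1} \<Longrightarrow> j \<in> {0, 1} \<Longrightarrow> A $$ (i, j) = B $$ (i, j)"
  shows "A = B"
  using assms by (intro eq_matI) (auto simp: less_2_cases_iff)

lemma eq_mat_4I:
  assumes "A \<in> carrier_mat 4 4" "B \<in> carrier_mat 4 4"
    and entries: "\<And>i j. i \<in> {0, 1, 2, 3} \<Longrightarrow> j \<in> {0, 1, 2, 3} \<Longrightarrow> A $$ (i, j) = B $$ (i, j)"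
  shows "A = B"
proof (rule eq_matI)
  fix i j
  assume "i < dim_row B" "j < dim_col B"
  then have "i \<in> {0, 1, 2, 3}" "j \<in> {0, 1, 2, 3}" using assms(2) by auto
  then show "A $$ (i, j) = B $$ (i, j)" by (rule entries)
qed (use assms in auto)

text \<open>Such a matrix is a reflection of the plane: \<open>trace\<close> cancels the
  off-diagonal entries of the square, and both diagonal entries are the sum in
  \<open>sq\<close>.\<close>

lemma pm_observable_real_2I:
  fixes a :: "real mat"
  assumes a: "a \<in> carrier_mat 2 2" and sym: "a $$ (1, 0) = a $$ (0, 1)"
    and sq: "a $$ (0, 0) * a $$ (0, 0) + a $$ (0, 1) * a $$ (0, 1) = 1"
    and trace: "a $$ (1, 1) = - a $$ (0, 0)"
  shows "pm_observable 2 a"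
proof -
  have "mat_adjoint a = a"
    using a sym by (intro eq_mat_2I) (auto simp: mat_adjoint_index intro!: carrier_matI)
  moreover have "a * a = 1\<^sub>m 2"
  proof (rule eq_mat_2I)
    fix i j :: nat
    have eq: "(a * a) $$ (i, j) = a $$ (i, 0) * a $$ (0, j) + a $$ (i, 1) * a $$ (1, j)"
      if "i < 2" "j < 2" using a that by (simp add: scalar_prod_def numeral_2_eq_2)
    assume "i \<in> {0, 1}" "j \<in> {0, 1}"
    then show "(a * a) $$ (i, j) = 1\<^sub>m 2 $$ (i, j)"
      using eq sq sym trace by (elim insertE emptyE) (simp_all add: add.commute)
  qed (use a in auto)
  ultimately show ?thesis using a by (simp add: pm_observable_def)
qed

lemma pm_observable_local_obs:
  assumes "a \<in> {pauli_Z, pauli_X, bob_plus, bob_minus}"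
  shows "pm_observable 2 a"
  using assms
  by (elim insertE emptyE; intro pm_observable_real_2I; simp)
    (simp_all add: local_obs_defs mat_of_rows_list_def)

lemma S_Q_carrier [simp]: "S_Q \<in> carrier_mat 4 4"
  by (rule carrier_matI) (simp_all add: S_Q_def mat_of_rows_list_def)

lemma S_Q_dim [simp]: "dim_row S_Q = 4" "dim_col S_Q = 4"
  using S_Q_carrier by (auto simp del: S_Q_carrier)

lemma chsh_local_obs:
  "chsh (kron pauli_Z (1\<^sub>m 2)) (kron pauli_X (1\<^sub>m 2)) (kron (1\<^sub>m 2) bob_plus) (kron (1\<^sub>m 2) bob_minus)
    = S_Q"
proof -
  \<comment> \<open>Every nonzero entry of the sum arises, up to sign, as \<open>1 / sqrt 2\<close>
    taken twice.\<close>
  have half: "2 / sqrt 2 = sqrt 2" by (simp add: real_div_sqrt)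
  have "kron pauli_Z bob_plus + kron pauli_Z bob_minus + kron pauli_X bob_plus
      - kron pauli_X bob_minus = S_Q"
  proof (rule eq_mat_4I)
    fix i j :: nat
    assume "i \<in> {0, 1, 2, 3}" "j \<in> {0, 1, 2, 3}"
    then show "(kron pauli_Z bob_plus + kron pauli_Z bob_minus + kron pauli_X bob_plus
        - kron pauli_X bob_minus) $$ (i, j) = S_Q $$ (i, j)"
      by (elim insertE emptyE; simp add: kron_index)
        (simp_all add: local_obs_defs mat_of_rows_list_def S_Q_def half)
  qed auto
  then show ?thesis by (simp add: chsh_kron [OF local_obs_carrier])
qed

section \<open>Spectrum and operator norm of \<open>S_Q\<close>\<close>

text \<open>The unnormalised Bell basis; its columns are orthogonal of norm \<open>\<surd>2\<close>, whence the factor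
  \<open>1 / 2\<close> in the inverse.\<close>

definition bell_mat :: "complex mat" where
  "bell_mat = mat_of_rows_list 4 [[1, 0, 0, 1], [0, 1, 1, 0], [0, -1, 1, 0], [1, 0, 0, -1]]"

lemma spec_S_Q:
  "spec (map_mat complex_of_real S_Q) =
     {# complex_of_real (2 * sqrt 2), complex_of_real (- 2 * sqrt 2), 0, 0 #}"
proof -
  \<comment> \<open>The eigenvalues follow the columns of \<open>bell_mat\<close>: the first is
    \<open>e0 + e3\<close>, the second \<open>e1 - e2\<close>, and the last two span the
    kernel.\<close>
  define D :: "complex mat" where
    "D = mat 4 4 (\<lambda>(i, j). if i = j then [of_real (2 * sqrt 2), of_real (- 2 * sqrt 2), 0, 0] ! i else 0)"
  define Q :: "complex mat" where "Q = (1 / 2) \<cdot>\<^sub>m transpose_mat bell_mat"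
  have [simp]: "dim_row bell_mat = 4" "dim_col bell_mat = 4" "dim_row D = 4" "dim_col D = 4"
    "dim_row Q = 4" "dim_col Q = 4"
    by (simp_all add: D_def Q_def bell_mat_def mat_of_rows_list_def)
  have sum_4: "(\<Sum>k = 0..<4. f k) = f 0 + f 1 + f 2 + f 3" for f :: "nat \<Rightarrow> complex"
    by (simp add: eval_nat_numeral)
  note entries = D_def Q_def bell_mat_def S_Q_def mat_of_rows_list_def
  have "similar_mat (map_mat complex_of_real S_Q) D"
  proof (rule similar_matI)
    show "{map_mat complex_of_real S_Q, D, bell_mat, Q} \<subseteq> carrier_mat 4 4"
      by auto
    show "bell_mat * Q = 1\<^sub>m 4"
      \<comment> \<open>The elimination is optional because the two carrier goals have no index
        assumption to split.\<close>
      by (rule eq_mat_4I; (elim insertE emptyE)?; simp add: scalar_prod_def sum_4 carrier_matI)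
        (simp_all add: entries)
    show "Q * bell_mat = 1\<^sub>m 4"
      by (rule eq_mat_4I; (elim insertE emptyE)?; simp add: scalar_prod_def sum_4 carrier_matI)
        (simp_all add: entries)
    show "map_mat complex_of_real S_Q = bell_mat * D * Q"
      by (rule eq_mat_4I; (elim insertE emptyE)?; simp add: scalar_prod_def sum_4 carrier_matI)
        (simp_all add: entries)
  qed
  then have "char_poly (map_mat complex_of_real S_Q) = char_poly D"
    by (rule char_poly_similar)
  also have "\<dots> = (\<Prod>a\<leftarrow>diag_mat D. [:- a, 1:])"
    by (rule char_poly_upper_triangular [of _ 4]) (auto simp: D_def upper_triangular_def)
  also have "diag_mat D = [of_real (2 * sqrt 2), of_real (- 2 * sqrt 2), 0, 0]"
    by (simp add: diag_mat_def D_def eval_nat_numeral)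
  \<comment> \<open>The linear factors must stay unexpanded so that \<open>proots_mult\<close> can
    read off one root from each.\<close>
  finally show ?thesis
    by (simp add: spec_def proots_mult del: mult_pCons_left mult_pCons_right)
qed

text \<open>The image of \<open>v\<close> depends only on \<open>v $ 0 + v $ 3\<close> and
  \<open>v $ 1 - v $ 2\<close>, so the parallelogram identity bounds its norm; an eigenvector
  attains the bound.\<close>

lemma operator_norm_S_Q: "operator_norm (map_mat complex_of_real S_Q) = 2 * sqrt 2"
proof -
  let ?S = "map_mat complex_of_real S_Q"
  have norm_eq: "euclidean_norm v =
      sqrt ((cmod (v $ 0))\<^sup>2 + (cmod (v $ 1))\<^sup>2 + (cmod (v $ 2))\<^sup>2 + (cmod (v $ 3))\<^sup>2)"
    if "v \<in> carrier_vec 4" for v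
    using that by (simp add: euclidean_norm_def eval_nat_numeral)
  have dim: "?S *\<^sub>v v \<in> carrier_vec 4" for v
    by (rule carrier_vecI) simp
  have norm_S: "euclidean_norm (?S *\<^sub>v v) =
      2 * sqrt ((cmod (v $ 0 + v $ 3))\<^sup>2 + (cmod (v $ 1 - v $ 2))\<^sup>2)"
    if v: "v \<in> carrier_vec 4" for v
  proof -
    have "(?S *\<^sub>v v) $ 0 = of_real (sqrt 2) * (v $ 0 + v $ 3)"
      "(?S *\<^sub>v v) $ 1 = - of_real (sqrt 2) * (v $ 1 - v $ 2)"
      "(?S *\<^sub>v v) $ 2 = of_real (sqrt 2) * (v $ 1 - v $ 2)"
      "(?S *\<^sub>v v) $ 3 = of_real (sqrt 2) * (v $ 0 + v $ 3)"
      using v by (simp_all add: S_Q_def mat_of_rows_list_def scalar_prod_def eval_nat_numeral algebra_simps)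
    \<comment> \<open>Each of the two combinations occurs in two entries with squared weight 2,
      whence the factor \<open>2\<^sup>2\<close>.\<close>
    then have "euclidean_norm (?S *\<^sub>v v) =
        sqrt (2\<^sup>2 * ((cmod (v $ 0 + v $ 3))\<^sup>2 + (cmod (v $ 1 - v $ 2))\<^sup>2))"
      unfolding norm_eq [OF dim] by (simp add: norm_mult power_mult_distrib)
    then show ?thesis by (simp only: real_sqrt_mult) simp
  qed
  have le: "euclidean_norm (?S *\<^sub>v v) \<le> 2 * sqrt 2"
    if v: "v \<in> carrier_vec 4" and unit: "euclidean_norm v = 1" for v
  proof -
    have par: "(cmod (x + y))\<^sup>2 + (cmod (x - y))\<^sup>2 = 2 * (cmod x)\<^sup>2 + 2 * (cmod y)\<^sup>2" for x y
      unfolding cmod_power2 by (simp add: power2_eq_square algebra_simps)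
    \<comment> \<open>Read backwards, \<open>par\<close> turns the right-hand side into the
      left-hand side plus a further square.\<close>
    have par_le: "(cmod (x + y))\<^sup>2 \<le> 2 * (cmod x)\<^sup>2 + 2 * (cmod y)\<^sup>2"
      "(cmod (x - y))\<^sup>2 \<le> 2 * (cmod x)\<^sup>2 + 2 * (cmod y)\<^sup>2" for x y
      by (simp_all flip: par)
    have "(cmod (v $ 0 + v $ 3))\<^sup>2 + (cmod (v $ 1 - v $ 2))\<^sup>2 \<le>
        2 * ((cmod (v $ 0))\<^sup>2 + (cmod (v $ 1))\<^sup>2 + (cmod (v $ 2))\<^sup>2 + (cmod (v $ 3))\<^sup>2)"
      using add_mono [OF par_le(1) [of "v $ 0" "v $ 3"] par_le(2) [of "v $ 1" "v $ 2"]]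
      by (simp add: algebra_simps)
    also have "\<dots> = 2" using unit by (simp add: norm_eq [OF v])
    finally show ?thesis by (simp add: norm_S [OF v])
  qed
  \<comment> \<open>The unit eigenvector \<open>(e0 + e3) / sqrt 2\<close> for the eigenvalue
    \<open>2 * sqrt 2\<close>.\<close>
  define w :: "complex vec" where
    "w = vec 4 (\<lambda>i. if i \<in> {0, 3} then of_real (1 / sqrt 2) else 0)"
  have w: "w \<in> carrier_vec 4" by (simp add: w_def)
  have w_nth: "w $ 0 = of_real (1 / sqrt 2)" "w $ 1 = 0" "w $ 2 = 0" "w $ 3 = of_real (1 / sqrt 2)"
    by (simp_all add: w_def)
  have "euclidean_norm w = 1"
    unfolding norm_eq [OF w] w_nth by (simp add: norm_divide power_divide)
  moreover have "euclidean_norm (?S *\<^sub>v w) = 2 * sqrt 2"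
  proof -
    have "w $ 0 + w $ 3 = of_real (sqrt 2)"
      unfolding w_nth of_real_add [symmetric] by (simp add: real_div_sqrt)
    then show ?thesis using w_nth(2,3) by (simp add: norm_S [OF w])
  qed
  \<comment> \<open>The supremum is a maximum, so membership of the value at \<open>w\<close> and
    the bound \<open>le\<close> suffice.\<close>
  ultimately show ?thesis
    unfolding operator_norm_def
    using le w by (intro cSup_eq_maximum) (auto intro!: exI [of _ w] simp: S_Q_def mat_of_rows_list_def)
qed

section \<open>The complex observables and their realification\<close>

theorem theorem7p2:
  shows "\<exists>A\<^sub>0 A\<^sub>1 B\<^sub>0 B\<^sub>1 :: complex mat.
      local_pm_observables A\<^sub>0 A\<^sub>1 B\<^sub>0 B\<^sub>1 \<and>
      spec (chsh A\<^sub>0 A\<^sub>1 B\<^sub>0 B\<^sub>1)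
        = {# complex_of_real (2 * sqrt 2), complex_of_real (- 2 * sqrt 2), 0, 0 #} \<and>
      operator_norm (chsh A\<^sub>0 A\<^sub>1 B\<^sub>0 B\<^sub>1) = 2 * sqrt 2 \<and>
      (\<exists>a\<^sub>0 a\<^sub>1 b\<^sub>0 b\<^sub>1 :: real mat.
         local_pm_observables a\<^sub>0 a\<^sub>1 b\<^sub>0 b\<^sub>1 \<and>
         realify A\<^sub>0 = kron a\<^sub>0 (1\<^sub>m 2) \<and> realify A\<^sub>1 = kron a\<^sub>1 (1\<^sub>m 2) \<and>
         realify B\<^sub>0 = kron b\<^sub>0 (1\<^sub>m 2) \<and> realify B\<^sub>1 = kron b\<^sub>1 (1\<^sub>m 2) \<and>
         chsh a\<^sub>0 a\<^sub>1 b\<^sub>0 b\<^sub>1 = S_Q) \<and>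
      realify (chsh A\<^sub>0 A\<^sub>1 B\<^sub>0 B\<^sub>1) = kron S_Q (1\<^sub>m 2) \<and>
      spec_real S_Q
        = {# complex_of_real (2 * sqrt 2), complex_of_real (- 2 * sqrt 2), 0, 0 #}"
proof -
  \<comment> \<open>The complex witnesses are the entrywise images under \<open>?c\<close> of the
    real ones, so that one choice serves both representations.\<close>
  let ?c = "map_mat complex_of_real"
  let ?a\<^sub>0 = "kron pauli_Z (1\<^sub>m 2)" and ?a\<^sub>1 = "kron pauli_X (1\<^sub>m 2)"
  let ?b\<^sub>0 = "kron (1\<^sub>m 2) bob_plus" and ?b\<^sub>1 = "kron (1\<^sub>m 2) bob_minus"
  have "local_pm_observables ?a\<^sub>0 ?a\<^sub>1 ?b\<^sub>0 ?b\<^sub>1"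
    by (intro local_pm_observables_kron ballI pm_observable_local_obs)
  moreover have "local_pm_observables (?c ?a\<^sub>0) (?c ?a\<^sub>1) (?c ?b\<^sub>0) (?c ?b\<^sub>1)"
    unfolding map_mat_of_real_kron of_real_hom.mat_hom_one
    by (rule local_pm_observables_kron)
      (auto intro!: pm_observable_of_real pm_observable_local_obs)
  moreover have "chsh (?c ?a\<^sub>0) (?c ?a\<^sub>1) (?c ?b\<^sub>0) (?c ?b\<^sub>1) = ?c S_Q"
  proof -
    have "chsh (?c ?a\<^sub>0) (?c ?a\<^sub>1) (?c ?b\<^sub>0) (?c ?b\<^sub>1) =
        kron (?c pauli_Z) (?c bob_plus) + kron (?c pauli_Z) (?c bob_minus) +
        kron (?c pauli_X) (?c bob_plus) - kron (?c pauli_X) (?c bob_minus)"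
      unfolding map_mat_of_real_kron of_real_hom.mat_hom_one
      by (rule chsh_kron) simp_all
    also have "\<dots> = ?c (chsh ?a\<^sub>0 ?a\<^sub>1 ?b\<^sub>0 ?b\<^sub>1)"
      unfolding chsh_kron [OF local_obs_carrier] map_mat_of_real_kron [symmetric]
      by (rule eq_matI) auto
    finally show ?thesis by (simp add: chsh_local_obs)
  qed
  \<comment> \<open>The conjunction is stated at the witnesses. Its realification clauses all follow
    from \<open>realify_of_real\<close>, since the observables and their CHSH operator
    \<open>?c S_Q\<close> are images under \<open>?c\<close>.\<close>
  ultimately have
    "local_pm_observables (?c ?a\<^sub>0) (?c ?a\<^sub>1) (?c ?b\<^sub>0) (?c ?b\<^sub>1) \<and>
      spec (chsh (?c ?a\<^sub>0) (?c ?a\<^sub>1) (?c ?b\<^sub>0) (?c ?b\<^sub>1))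
        = {# complex_of_real (2 * sqrt 2), complex_of_real (- 2 * sqrt 2), 0, 0 #} \<and>
      operator_norm (chsh (?c ?a\<^sub>0) (?c ?a\<^sub>1) (?c ?b\<^sub>0) (?c ?b\<^sub>1)) = 2 * sqrt 2 \<and>
      (local_pm_observables ?a\<^sub>0 ?a\<^sub>1 ?b\<^sub>0 ?b\<^sub>1 \<and>
         realify (?c ?a\<^sub>0) = kron ?a\<^sub>0 (1\<^sub>m 2) \<and> realify (?c ?a\<^sub>1) = kron ?a\<^sub>1 (1\<^sub>m 2) \<and>
         realify (?c ?b\<^sub>0) = kron ?b\<^sub>0 (1\<^sub>m 2) \<and> realify (?c ?b\<^sub>1) = kron ?b\<^sub>1 (1\<^sub>m 2) \<and>
         chsh ?a\<^sub>0 ?a\<^sub>1 ?b\<^sub>0 ?b\<^sub>1 = S_Q) \<and>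
      realify (chsh (?c ?a\<^sub>0) (?c ?a\<^sub>1) (?c ?b\<^sub>0) (?c ?b\<^sub>1)) = kron S_Q (1\<^sub>m 2) \<and>
      spec_real S_Q
        = {# complex_of_real (2 * sqrt 2), complex_of_real (- 2 * sqrt 2), 0, 0 #}"
    by (simp only: spec_S_Q operator_norm_S_Q chsh_local_obs realify_of_real spec_real_def simp_thms)
  then show ?thesis by blast
qed

end
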